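(* Let $\mathcal{A}\subseteq h_d$ be a bounded subset of the Banach space $h_d$. Then the Hausdorff measure of noncompactness of $\mathcal{A}$ is given by $$\chi(\mathcal{A})=\lim_{k\to\infty}\left\{\sup_{\mathfrak{m}\in\mathcal{A}}\left\{\sum_{n\ge k}|d_n|\,|\Delta\mathfrak{m}_n|\right\}\right\}.$$
   Context: Let $d=(d_n)_{n=1}^\infty$ be an unbounded, monotonically increasing sequence of positive real numbers. Let $\omega$ be the set of all complex sequences $\mathfrak{m}=(\mathfrak{m}_n)_{n=1}^\infty$, let $c_0\subset\omega$ be the set of null sequences, and put $\Delta\mathfrak{m}_n=\mathfrak{m}_n-\mathfrak{m}_{n+1}$. The generalized Hahn sequence space is $$h_d=\Big\{\mathfrak{m}\in\omega:\sum_{n=1}^\infty |d_n|\,|\Delta\mathfrak{m}_n|<\infty\Big\}\cap c_0,$$ a Banach space with norm $\|\mathfrak{m}\|_{h_d}=\sum_{n=1}^\infty d_n|\Delta\mathfrak{m}_n|$. The Hausdorff measure of noncompactness $\chi(\mathcal{A})$ of a bounded set $\mathcal{A}\subseteq h_d$ is the infimum of all $\varepsilon>0$ such that $\mathcal{A}$ is contained in a union of finitely many closed balls of $h_d$ with centres in $h_d$ and radii less than $\varepsilon$. *)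

theory Defs
  imports "HOL-Analysis.Analysis"
begin

(* Sequences are indexed from 0: d n and m n stand for the (n+1)-st terms of the sequences. *)

definition Delta :: "(nat \<Rightarrow> complex) \<Rightarrow> nat \<Rightarrow> complex" where
  "Delta m n = m n - m (Suc n)"

definition hahn_space :: "(nat \<Rightarrow> real) \<Rightarrow> (nat \<Rightarrow> complex) set" where
  "hahn_space d =
     {m. (\<lambda>n. \<bar>d n\<bar> * cmod (Delta m n)) summable_on UNIV} \<inter> {m. m \<longlonglongrightarrow> 0}"

(* The sums below have nonnegative terms, so the unordered sum agrees with the series; it is
   0 if the series diverges, which does not happen on hahn_space d. *)
definition hahn_norm :: "(nat \<Rightarrow> real) \<Rightarrow> (nat \<Rightarrow> complex) \<Rightarrow> real" where
  "hahn_norm d m = (\<Sum>\<^sub>\<infinity>n. d n * cmod (Delta m n))"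

definition hahn_dist :: "(nat \<Rightarrow> real) \<Rightarrow> (nat \<Rightarrow> complex) \<Rightarrow> (nat \<Rightarrow> complex) \<Rightarrow> real" where
  "hahn_dist d x y = hahn_norm d (\<lambda>n. x n - y n)"

(* The members (c, r) of B are the centres and radii of the closed balls of the cover.
   If S is bounded, the set of admissible \<epsilon> is nonempty, so the real infimum is meaningful. *)
definition (in Metric_space) hausdorff_mnc :: "'a set \<Rightarrow> real" where
  "hausdorff_mnc S =
     Inf {\<epsilon>. \<epsilon> > 0 \<and>
            (\<exists>B. finite B \<and> B \<subseteq> M \<times> {0..<\<epsilon>} \<and> S \<subseteq> (\<Union>(c, r)\<in>B. mcball c r))}"

lemma hahn_space_diff_summable:
  assumes "\<And>n. 0 < d n" "x \<in> hahn_space d" "y \<in> hahn_space d"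
  shows "(\<lambda>n. d n * cmod (Delta (\<lambda>n. x n - y n) n)) summable_on UNIV"
proof -
  have s: "(\<lambda>n. d n * cmod (Delta x n) + d n * cmod (Delta y n)) summable_on UNIV"
    using assms(2,3) unfolding hahn_space_def
    by (intro summable_on_add) (simp_all add: abs_of_pos assms(1))
  show ?thesis
  proof (rule summable_on_comparison_test[OF s])
    fix n :: nat
    have "cmod (Delta (\<lambda>n. x n - y n) n) \<le> cmod (Delta x n) + cmod (Delta y n)"
      using norm_triangle_ineq4[of "Delta x n" "Delta y n"] by (simp add: Delta_def algebra_simps)
    then show "d n * cmod (Delta (\<lambda>n. x n - y n) n) \<le> d n * cmod (Delta x n) + d n * cmod (Delta y n)"
      using assms(1)[of n] by (metis distrib_left mult_left_mono less_imp_le)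
    show "0 \<le> d n * cmod (Delta (\<lambda>n. x n - y n) n)"
      using assms(1)[of n] by simp
  qed
qed

lemma Metric_space_hahn:
  assumes pos: "\<And>n. 0 < d n"
  shows "Metric_space (hahn_space d) (hahn_dist d)"
proof
  have nn: "0 \<le> d n * cmod z" for n z
    using pos[of n] by simp
  fix x y z
  show "0 \<le> hahn_dist d x y"
    unfolding hahn_dist_def hahn_norm_def by (intro infsum_nonneg nn)
  have "cmod (Delta (\<lambda>n. x n - y n) n) = cmod (Delta (\<lambda>n. y n - x n) n)" for n
    using norm_minus_commute[of "x n - y n" "x (Suc n) - y (Suc n)"]
    by (simp add: Delta_def algebra_simps)
  then show "hahn_dist d x y = hahn_dist d y x"
    by (simp add: hahn_dist_def hahn_norm_def)
  assume x: "x \<in> hahn_space d" and y: "y \<in> hahn_space d"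
  show "hahn_dist d x y = 0 \<longleftrightarrow> x = y"
  proof
    assume "x = y"
    then show "hahn_dist d x y = 0"
      by (simp add: hahn_dist_def hahn_norm_def Delta_def)
  next
    assume "hahn_dist d x y = 0"
    then have "d n * cmod (Delta (\<lambda>n. x n - y n) n) = 0" for n
      using nonneg_infsum_le_0D[OF _ hahn_space_diff_summable[OF pos x y], of n] nn
      by (simp add: hahn_dist_def hahn_norm_def)
    then have "Delta (\<lambda>n. x n - y n) n = 0" for n
      using pos[of n] by (metis mult_eq_0_iff norm_eq_zero less_irrefl)
    then have step: "x (Suc n) - y (Suc n) = x n - y n" for n
      by (simp add: Delta_def)
    have const: "x n - y n = x 0 - y 0" for n
      by (induction n) (simp_all add: step)
    have "(\<lambda>n. x n - y n) \<longlonglongrightarrow> 0 - 0"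
      using x y unfolding hahn_space_def by (intro tendsto_diff) auto
    moreover have "(\<lambda>n. x n - y n) = (\<lambda>n. x 0 - y 0)"
      by (rule ext) (rule const)
    ultimately have "(\<lambda>n::nat. x 0 - y 0) \<longlonglongrightarrow> 0"
      by (metis diff_0_right)
    then have "x 0 - y 0 = 0"
      by (simp add: tendsto_const_iff)
    then have "x n = y n" for n
      using const[of n] by simp
    then show "x = y" by auto
  qed
  assume z: "z \<in> hahn_space d"
  have "hahn_dist d x z \<le> (\<Sum>\<^sub>\<infinity>n. d n * cmod (Delta (\<lambda>n. x n - y n) n) + d n * cmod (Delta (\<lambda>n. y n - z n) n))"
    unfolding hahn_dist_def hahn_norm_def
  proof (rule infsum_mono)
    fix n :: nat
    have "cmod (Delta (\<lambda>n. x n - z n) n) \<le> cmod (Delta (\<lambda>n. x n - y n) n) + cmod (Delta (\<lambda>n. y n - z n) n)"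
      using norm_triangle_ineq[of "Delta (\<lambda>n. x n - y n) n" "Delta (\<lambda>n. y n - z n) n"]
      by (simp add: Delta_def algebra_simps)
    then show "d n * cmod (Delta (\<lambda>n. x n - z n) n)
        \<le> d n * cmod (Delta (\<lambda>n. x n - y n) n) + d n * cmod (Delta (\<lambda>n. y n - z n) n)"
      using pos[of n] by (metis distrib_left mult_left_mono less_imp_le)
  qed (intro summable_on_add hahn_space_diff_summable pos x y z)+
  also have "\<dots> = hahn_dist d x y + hahn_dist d y z"
    unfolding hahn_dist_def hahn_norm_def
    by (intro infsum_add hahn_space_diff_summable pos x y z)
  finally show "hahn_dist d x z \<le> hahn_dist d x y + hahn_dist d y z" .
qed

end

theory Submission
  imports Defs
begin

text \<open>
  For a cutoff \<open>k\<close> split the norm of \<open>m\<close> into the head, the sum of the terms with \<open>n < k\<close>, and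
  the tail, the sum of those with \<open>n \<ge> k\<close>. Two facts about this splitting carry the proof.

  The tails of any finite set of sequences are uniformly small once \<open>k\<close> is large, and the tail is a
  seminorm dominated by the norm. So if finitely many balls of radius less than \<open>\<epsilon>\<close> cover \<open>A\<close>, the
  tails of the centres eventually contribute at most \<open>\<delta>\<close>, and every member of \<open>A\<close> then has tail at
  most \<open>\<epsilon> + \<delta>\<close> (\<open>INF_tails_le_radius\<close>). Hence the limit of the suprema is at most the measure of
  noncompactness.

  Conversely, the first \<open>k\<close> differences of the members of the bounded set \<open>A\<close> range over a bounded
  subset of a finite-dimensional space, so they have a finite \<open>\<delta>\<close>-net (\<open>head_net\<close>). Each point of
  the net lists the first \<open>k\<close> differences of a sequence vanishing from \<open>k\<close> on (\<open>from_diffs\<close>).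
  Around these sequences the balls whose radius is \<open>\<delta>\<close> plus the supremum of the tails cover
  \<open>A\<close> (\<open>cover_of_tail_bound\<close>), so for every \<open>k\<close> the measure of noncompactness is at most the
  supremum of the tails.

  Since the suprema decrease in \<open>k\<close>, their limit is their infimum.
\<close>

section \<open>Heads and tails of the norm\<close>

definition hahn_tail :: "(nat \<Rightarrow> real) \<Rightarrow> nat \<Rightarrow> (nat \<Rightarrow> complex) \<Rightarrow> real" where
  "hahn_tail d k m = (\<Sum>\<^sub>\<infinity>n\<in>{k..}. d n * cmod (Delta m n))"

lemma hahn_space_summable:
  assumes "\<And>n. 0 < d n" "m \<in> hahn_space d"
  shows "(\<lambda>n. d n * cmod (Delta m n)) summable_on S"
proof -
  have "(\<lambda>n. d n * cmod (Delta m n)) summable_on UNIV"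
    using assms unfolding hahn_space_def by (simp add: abs_of_pos)
  then show ?thesis
    by (rule summable_on_subset_banach) simp
qed

lemma infsum_split_at:
  fixes f :: "nat \<Rightarrow> real"
  assumes "f summable_on UNIV"
  shows "infsum f UNIV = (\<Sum>n<k. f n) + infsum f {k..}"
proof -
  have "infsum f ({..<k} \<union> {k..}) = infsum f {..<k} + infsum f {k..}"
    by (intro infsum_Un_disjoint summable_on_subset_banach[OF assms]) auto
  moreover have "{..<k} \<union> {k..} = UNIV" by auto
  ultimately show ?thesis by simp
qed

lemma infsum_tail_tendsto_0:
  fixes f :: "nat \<Rightarrow> real"
  assumes "f summable_on UNIV"
  shows "(\<lambda>k. infsum f {k..}) \<longlonglongrightarrow> 0"
proof -
  have "f sums infsum f UNIV"
    using assms by (simp add: has_sum_imp_sums)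
  then have "(\<lambda>k. infsum f UNIV - (\<Sum>n<k. f n)) \<longlonglongrightarrow> infsum f UNIV - infsum f UNIV"
    unfolding sums_def by (intro tendsto_intros)
  moreover have "infsum f {k..} = infsum f UNIV - (\<Sum>n<k. f n)" for k
    using infsum_split_at[OF assms, of k] by simp
  ultimately show ?thesis by simp
qed

lemma hahn_tail_antimono:
  assumes "\<And>n. 0 < d n" "m \<in> hahn_space d" "j \<le> k"
  shows "hahn_tail d k m \<le> hahn_tail d j m"
  unfolding hahn_tail_def
  using assms by (intro infsum_mono_neutral hahn_space_summable) (auto simp: less_imp_le)

lemma hahn_dist_eq_head_plus_tail:
  assumes "\<And>n. 0 < d n" "x \<in> hahn_space d" "y \<in> hahn_space d"
  shows "hahn_dist d x y =
    (\<Sum>n<k. d n * cmod (Delta x n - Delta y n)) + hahn_tail d k (\<lambda>n. x n - y n)"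
proof -
  have "Delta (\<lambda>n. x n - y n) n = Delta x n - Delta y n" for n
    by (simp add: Delta_def)
  then show ?thesis
    using infsum_split_at[OF hahn_space_diff_summable[OF assms], of k]
    by (simp add: hahn_dist_def hahn_norm_def hahn_tail_def)
qed

lemma hahn_tail_le_dist_plus_tail:
  assumes pos: "\<And>n. 0 < d n" and x: "x \<in> hahn_space d" and y: "y \<in> hahn_space d"
  shows "hahn_tail d k x \<le> hahn_dist d y x + hahn_tail d k y"
proof -
  let ?u = "\<lambda>n. d n * cmod (Delta (\<lambda>n. y n - x n) n)"
  have u: "?u summable_on S" for S
    by (rule summable_on_subset_banach[OF hahn_space_diff_summable[OF pos y x]]) simp
  have "hahn_tail d k x \<le> (\<Sum>\<^sub>\<infinity>n\<in>{k..}. ?u n + d n * cmod (Delta y n))"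
    unfolding hahn_tail_def
  proof (rule infsum_mono)
    fix n
    have "cmod (Delta x n) \<le> cmod (Delta (\<lambda>n. y n - x n) n) + cmod (Delta y n)"
      using norm_triangle_ineq4[of "Delta y n" "Delta (\<lambda>n. y n - x n) n"]
      by (simp add: Delta_def algebra_simps)
    then show "d n * cmod (Delta x n) \<le> ?u n + d n * cmod (Delta y n)"
      using pos[of n] by (metis distrib_left mult_left_mono less_imp_le)
  qed (intro summable_on_add hahn_space_summable u pos x y)+
  also have "\<dots> = infsum ?u {k..} + hahn_tail d k y"
    unfolding hahn_tail_def by (intro infsum_add hahn_space_summable u pos y)
  also have "infsum ?u {k..} \<le> hahn_dist d y x"
    unfolding hahn_dist_def hahn_norm_def
    using pos by (intro infsum_mono_neutral u) (auto simp: less_imp_le)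
  finally show ?thesis by simp
qed

section \<open>Sequences with finitely many nonzero differences\<close>

text \<open>The null sequence whose differences are \<open>f 0, \<dots>, f (k - 1), 0, 0, \<dots>\<close>.\<close>

definition from_diffs :: "nat \<Rightarrow> (nat \<Rightarrow> complex) \<Rightarrow> nat \<Rightarrow> complex" where
  "from_diffs k f n = (\<Sum>i=n..<k. f i)"

lemma Delta_from_diffs: "Delta (from_diffs k f) n = (if n < k then f n else 0)"
  by (simp add: Delta_def from_diffs_def sum.atLeast_Suc_lessThan)

lemma from_diffs_in_hahn_space: "from_diffs k f \<in> hahn_space d"
proof -
  have "(\<lambda>n. \<bar>d n\<bar> * cmod (Delta (from_diffs k f) n)) summable_on {..<k}"
    by simp
  then have "(\<lambda>n. \<bar>d n\<bar> * cmod (Delta (from_diffs k f) n)) summable_on UNIV"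
    by (rule summable_on_cong_neutral[THEN iffD1, rotated -1]) (auto simp: Delta_from_diffs)
  moreover have "from_diffs k f \<longlonglongrightarrow> 0"
    by (rule tendsto_eventually)
      (auto simp: from_diffs_def eventually_sequentially intro!: exI[of _ k])
  ultimately show ?thesis
    by (simp add: hahn_space_def)
qed

lemma hahn_dist_from_diffs:
  assumes "\<And>n. 0 < d n" "m \<in> hahn_space d"
  shows "hahn_dist d (from_diffs k f) m = (\<Sum>n<k. d n * cmod (Delta m n - f n)) + hahn_tail d k m"
proof -
  have "hahn_tail d k (\<lambda>n. from_diffs k f n - m n) = hahn_tail d k m"
    unfolding hahn_tail_def
  proof (rule infsum_cong)
    fix n assume "n \<in> {k..}"
    then have "Delta (\<lambda>n. from_diffs k f n - m n) n = - Delta m n"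
      by (simp add: Delta_def from_diffs_def)
    then show "d n * cmod (Delta (\<lambda>n. from_diffs k f n - m n) n) = d n * cmod (Delta m n)"
      by simp
  qed
  then show ?thesis
    using hahn_dist_eq_head_plus_tail[OF assms(1) from_diffs_in_hahn_space assms(2), of k f k]
    by (simp add: Delta_from_diffs norm_minus_commute)
qed

section \<open>Finite covers and tails\<close>

text \<open>
  A product of \<open>k\<close> compact discs is totally bounded: the product of finite nets of the discs is a
  finite net.
\<close>

lemma head_net:
  fixes d :: "nat \<Rightarrow> real"
  assumes pos: "\<And>n. 0 < d n" and "0 < \<delta>"
  obtains F :: "(nat \<Rightarrow> complex) set" where "finite F"
    and "\<And>z. (\<And>n. n < k \<Longrightarrow> d n * cmod (z n) \<le> R) \<Longrightarrow>
           \<exists>f\<in>F. (\<Sum>n<k. d n * cmod (z n - f n)) \<le> \<delta>"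
proof -
  \<comment> \<open>Each of the \<open>k\<close> weighted errors is to be at most \<open>\<delta> / (k + 1)\<close>; \<open>k + 1\<close> instead of \<open>k\<close>
    avoids a division by zero.\<close>
  define \<eta> where "\<eta> n = \<delta> / (real (Suc k) * d n)" for n
  have \<eta>: "0 < \<eta> n" for n
    unfolding \<eta>_def using pos[of n] \<open>0 < \<delta>\<close> by simp
  have "\<exists>N. finite N \<and> cball (0::complex) (R / d n) \<subseteq> (\<Union>x\<in>N. ball x (\<eta> n))" for n
    using compact_cball[of "0::complex" "R / d n"] \<eta>[of n]
    unfolding compact_eq_totally_bounded by blast
  then obtain N where N: "\<And>n. finite (N n)"
      "\<And>n. cball (0::complex) (R / d n) \<subseteq> (\<Union>x\<in>N n. ball x (\<eta> n))"
    by metis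
  show ?thesis
  proof (rule that)
    show "finite (Pi\<^sub>E {..<k} N)"
      by (intro finite_PiE N) simp
  next
    fix z assume z: "\<And>n. n < k \<Longrightarrow> d n * cmod (z n) \<le> R"
    have "\<exists>x\<in>N n. dist x (z n) < \<eta> n" if "n < k" for n
    proof -
      have "z n \<in> cball 0 (R / d n)"
        using z[OF that] pos[of n] by (simp add: field_simps)
      then have "z n \<in> (\<Union>x\<in>N n. ball x (\<eta> n))"
        using N(2) by (rule subsetD[rotated])
      then show ?thesis by simp
    qed
    then obtain g where g: "\<And>n. n < k \<Longrightarrow> g n \<in> N n \<and> dist (g n) (z n) < \<eta> n"
      by metis
    have "(\<Sum>n<k. d n * cmod (z n - restrict g {..<k} n)) \<le> (\<Sum>n<k. \<delta> / real (Suc k))"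
    proof (rule sum_mono)
      fix n assume n: "n \<in> {..<k}"
      then have "d n * cmod (z n - g n) \<le> d n * \<eta> n"
        using g[of n] pos[of n] by (simp add: dist_norm norm_minus_commute less_imp_le)
      also have "\<dots> = \<delta> / real (Suc k)"
        using pos[of n] by (simp add: \<eta>_def)
      finally show "d n * cmod (z n - restrict g {..<k} n) \<le> \<delta> / real (Suc k)"
        using n by simp
    qed
    also have "\<dots> \<le> \<delta>"
      using \<open>0 < \<delta>\<close> by (simp add: field_simps)
    finally show "\<exists>f\<in>Pi\<^sub>E {..<k} N. (\<Sum>n<k. d n * cmod (z n - f n)) \<le> \<delta>"
      using g by (intro bexI[of _ "restrict g {..<k}"]) auto
  qed
qed

text \<open>
  The centres have no tail, so the distance of \<open>m\<close> from the centre of a nearby net point is the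
  error of the net in the head of \<open>m\<close> plus the whole tail of \<open>m\<close>.
\<close>

lemma cover_of_tail_bound:
  assumes pos: "\<And>n. 0 < d n" and A: "A \<subseteq> hahn_space d"
    and R: "\<And>m. m \<in> A \<Longrightarrow> hahn_norm d m \<le> R"
    and t: "\<And>m. m \<in> A \<Longrightarrow> hahn_tail d k m \<le> t"
    and "0 < \<delta>"
  obtains C where "finite C" "C \<subseteq> hahn_space d"
    "\<And>m. m \<in> A \<Longrightarrow> \<exists>c\<in>C. hahn_dist d c m \<le> t + \<delta>"
proof -
  obtain F where F: "finite F" "\<And>z. (\<And>n. n < k \<Longrightarrow> d n * cmod (z n) \<le> R) \<Longrightarrow>
           \<exists>f\<in>F. (\<Sum>n<k. d n * cmod (z n - f n)) \<le> \<delta>"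
    by (rule head_net[where d = d, OF pos \<open>0 < \<delta>\<close>, of k R]) blast
  have "\<exists>c\<in>from_diffs k ` F. hahn_dist d c m \<le> t + \<delta>" if m: "m \<in> A" for m
  proof -
    have mS: "m \<in> hahn_space d" using m A by auto
    have "d n * cmod (Delta m n) \<le> R" for n
    proof -
      have "d n * cmod (Delta m n) = (\<Sum>\<^sub>\<infinity>i\<in>{n}. d i * cmod (Delta m i))"
        by simp
      also have "\<dots> \<le> hahn_norm d m"
        unfolding hahn_norm_def using pos
        by (intro infsum_mono_neutral hahn_space_summable mS) (auto simp: less_imp_le)
      finally show ?thesis using R[OF m] by simp
    qed
    then obtain f where "f \<in> F" "(\<Sum>n<k. d n * cmod (Delta m n - f n)) \<le> \<delta>"
      using F(2) by blast
    then show ?thesis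
      using hahn_dist_from_diffs[OF pos mS, of k f] t[OF m]
      by (intro bexI[of _ "from_diffs k f"]) auto
  qed
  with F(1) show ?thesis
    by (intro that[of "from_diffs k ` F"]) (auto simp: from_diffs_in_hahn_space)
qed

text \<open>
  A finite set of centres has uniformly small tails from some \<open>k\<close> on, and passing from a centre to a
  point of its ball adds at most \<open>\<epsilon>\<close> to the tail.
\<close>

lemma INF_tails_le_radius:
  assumes pos: "\<And>n. 0 < d n" and A: "A \<subseteq> hahn_space d"
    and C: "finite C" "C \<subseteq> hahn_space d"
    and cover: "\<And>m. m \<in> A \<Longrightarrow> \<exists>c\<in>C. hahn_dist d c m \<le> \<epsilon>"
    and "0 \<le> \<epsilon>"
  shows "(INF k. SUP m\<in>A. ennreal (hahn_tail d k m)) \<le> ennreal \<epsilon>"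
proof (rule ennreal_le_epsilon)
  fix \<delta> :: real assume "0 < \<delta>"
  have "\<forall>\<^sub>F k in sequentially. hahn_tail d k c < \<delta>" if "c \<in> C" for c
  proof -
    have "(\<lambda>k. hahn_tail d k c) \<longlonglongrightarrow> 0"
      unfolding hahn_tail_def using that C(2) pos
      by (intro infsum_tail_tendsto_0 hahn_space_summable) auto
    then show ?thesis using \<open>0 < \<delta>\<close> by (rule order_tendstoD)
  qed
  then have "\<forall>\<^sub>F k in sequentially. \<forall>c\<in>C. hahn_tail d k c < \<delta>"
    using C(1) by (simp add: eventually_ball_finite_distrib)
  then obtain k where k: "\<And>c. c \<in> C \<Longrightarrow> hahn_tail d k c < \<delta>"
    by (auto simp: eventually_sequentially)
  have "hahn_tail d k m \<le> \<epsilon> + \<delta>" if m: "m \<in> A" for m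
  proof -
    obtain c where c: "c \<in> C" "hahn_dist d c m \<le> \<epsilon>" using cover[OF m] by blast
    have "hahn_tail d k m \<le> hahn_dist d c m + hahn_tail d k c"
      using m A c C by (intro hahn_tail_le_dist_plus_tail pos) auto
    then show ?thesis using c(2) k[OF c(1)] by simp
  qed
  then have "(SUP m\<in>A. ennreal (hahn_tail d k m)) \<le> ennreal (\<epsilon> + \<delta>)"
    by (intro SUP_least ennreal_leI)
  then show "(INF k. SUP m\<in>A. ennreal (hahn_tail d k m)) \<le> ennreal \<epsilon> + ennreal \<delta>"
    using \<open>0 \<le> \<epsilon>\<close> \<open>0 < \<delta>\<close> by (subst ennreal_plus[symmetric]) (auto intro: INF_lower2)
qed

section \<open>The formula for the measure of noncompactness\<close>

lemma mbounded_imp_hahn_norm_bounded: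
  assumes pos: "\<And>n. 0 < d n"
    and "Metric_space.mbounded (hahn_space d) (hahn_dist d) A"
  obtains R where "\<And>m. m \<in> A \<Longrightarrow> hahn_norm d m \<le> R"
proof -
  interpret Metric_space "hahn_space d" "hahn_dist d"
    by (rule Metric_space_hahn[OF pos])
  have "(\<lambda>n. 0) \<in> hahn_space d"
    by (simp add: hahn_space_def Delta_def)
  then have "mbounded (insert (\<lambda>n. 0) A)"
    using assms(2) by (simp add: mbounded_insert)
  then obtain R where "\<And>m. m \<in> A \<Longrightarrow> hahn_dist d m (\<lambda>n. 0) \<le> R"
    unfolding mbounded_alt by blast
  then show ?thesis
    by (intro that) (simp add: hahn_dist_def)
qed

text \<open>
  Covers by balls of one common radius \<open>r\<close> suffice for upper bounds. Strictness in \<open>r < \<epsilon>\<close> comes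
  from the covers admitted for \<open>\<epsilon>\<close>, whose radii lie below \<open>\<epsilon>\<close>.
\<close>

lemma hausdorff_mnc_hahn_le:
  assumes pos: "\<And>n. 0 < d n" and A: "A \<subseteq> hahn_space d"
    and C: "finite C" "C \<subseteq> hahn_space d"
    and cover: "\<And>m. m \<in> A \<Longrightarrow> \<exists>c\<in>C. hahn_dist d c m \<le> r"
    and "0 \<le> r" "r < \<epsilon>"
  shows "Metric_space.hausdorff_mnc (hahn_space d) (hahn_dist d) A \<le> \<epsilon>"
proof -
  interpret Metric_space "hahn_space d" "hahn_dist d"
    by (rule Metric_space_hahn[OF pos])
  have "A \<subseteq> (\<Union>(c, r)\<in>C \<times> {r}. mcball c r)"
    using A C(2) cover by fastforce
  then show ?thesis
    unfolding hausdorff_mnc_def using C \<open>0 \<le> r\<close> \<open>r < \<epsilon>\<close>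
    by (intro cInf_lower bdd_belowI[of _ 0]) (auto intro!: exI[of _ "C \<times> {r}"])
qed

theorem theorem3p1:
  fixes d :: "nat \<Rightarrow> real" and A :: "(nat \<Rightarrow> complex) set"
  assumes "\<And>n. 0 < d n"
    and "incseq d"
    and "\<not> bdd_above (range d)"
    and "A \<subseteq> hahn_space d"
    and "Metric_space.mbounded (hahn_space d) (hahn_dist d) A"
  shows "(\<lambda>k. SUP m\<in>A. ennreal (\<Sum>\<^sub>\<infinity>n\<in>{k..}. \<bar>d n\<bar> * cmod (Delta m n)))
           \<longlonglongrightarrow> ennreal (Metric_space.hausdorff_mnc (hahn_space d) (hahn_dist d) A)"
proof -
  note pos = assms(1) and A = assms(4)
  interpret Metric_space "hahn_space d" "hahn_dist d"
    by (rule Metric_space_hahn[OF pos])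
  define E where "E k = (SUP m\<in>A. ennreal (hahn_tail d k m))" for k
  let ?\<chi> = "hausdorff_mnc A"
  let ?S = "{\<epsilon>. \<epsilon> > 0 \<and>
    (\<exists>B. finite B \<and> B \<subseteq> hahn_space d \<times> {0..<\<epsilon>} \<and> A \<subseteq> (\<Union>(c, r)\<in>B. mcball c r))}"
  obtain R where R: "\<And>m. m \<in> A \<Longrightarrow> hahn_norm d m \<le> R"
    by (rule mbounded_imp_hahn_norm_bounded[where d = d, OF pos assms(5)]) blast
  have lower: "ennreal ?\<chi> \<le> E k" for k
  proof (cases "E k = top")
    case False
    then obtain t where t: "E k = ennreal t" "0 \<le> t"
      by (cases "E k") auto
    have tail: "hahn_tail d k m \<le> t" if "m \<in> A" for m
    proof -
      have "ennreal (hahn_tail d k m) \<le> ennreal t"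
        using that unfolding t(1)[symmetric] E_def by (rule SUP_upper)
      then show ?thesis using t(2) by simp
    qed
    have "?\<chi> \<le> t + \<delta>" if "0 < \<delta>" for \<delta>
    proof -
      \<comment> \<open>One half of \<open>\<delta>\<close> pays for the net, the other for the strict bound on the radii.\<close>
      have "0 < \<delta> / 2" using that by simp
      then obtain C where "finite C" "C \<subseteq> hahn_space d"
          "\<And>m. m \<in> A \<Longrightarrow> \<exists>c\<in>C. hahn_dist d c m \<le> t + \<delta> / 2"
        using cover_of_tail_bound[OF pos A R tail, of "\<delta> / 2"] by blast
      then show ?thesis
        using t(2) that by (intro hausdorff_mnc_hahn_le[OF pos A, where r = "t + \<delta> / 2"]) auto
    qed
    then have "?\<chi> \<le> t" by (rule field_le_epsilon)
    then show ?thesis using t by (simp add: ennreal_leI)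
  qed simp
  have upper: "(INF k. E k) \<le> ennreal \<epsilon>" if S: "\<epsilon> \<in> ?S" for \<epsilon>
  proof -
    obtain B where B: "finite B" "B \<subseteq> hahn_space d \<times> {0..<\<epsilon>}" "A \<subseteq> (\<Union>(c, r)\<in>B. mcball c r)"
      and \<epsilon>: "0 < \<epsilon>"
      using S by blast
    have "\<exists>c\<in>fst ` B. hahn_dist d c m \<le> \<epsilon>" if m: "m \<in> A" for m
    proof -
      obtain c r where cr: "(c, r) \<in> B" "m \<in> mcball c r" using subsetD[OF B(3) m] by blast
      then have "hahn_dist d c m \<le> r" by simp
      moreover have "r < \<epsilon>" using cr B(2) by auto
      ultimately have "hahn_dist d c m \<le> \<epsilon>" by simp
      then show ?thesis using cr(1) by (force intro: bexI[of _ c])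
    qed
    then show ?thesis
      unfolding E_def using B \<epsilon> by (intro INF_tails_le_radius[OF pos A, of "fst ` B"]) auto
  qed
  have "(INF k. E k) \<le> ennreal ?\<chi>"
  proof -
    \<comment> \<open>The ball of radius \<open>max 0 R\<close> about \<open>0\<close> covers \<open>A\<close>, so the infimum defining \<open>?\<chi>\<close>
      is over a nonempty set.\<close>
    have ne: "max 0 R + 1 \<in> ?S"
    proof -
      have "(\<lambda>n. 0) \<in> hahn_space d"
        by (simp add: hahn_space_def Delta_def)
      moreover have "hahn_dist d (\<lambda>n. 0) m \<le> max 0 R" if "m \<in> A" for m
        using R[OF that] commute[of "\<lambda>n. 0" m] by (simp add: hahn_dist_def)
      ultimately show ?thesis
        using A by (auto intro!: exI[of _ "{(\<lambda>n. 0, max 0 R)}"])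
    qed
    have "(INF k. E k) < top"
      using upper[OF ne] by (auto simp: le_less_trans)
    then obtain u where u: "(INF k. E k) = ennreal u" "0 \<le> u"
      by (cases "INF k. E k") auto
    have "u \<le> \<epsilon>" if "\<epsilon> \<in> ?S" for \<epsilon>
      using upper[OF that] that u by simp
    with ne have "u \<le> ?\<chi>"
      unfolding hausdorff_mnc_def by (intro cInf_greatest) blast+
    then show ?thesis using u by (simp add: ennreal_leI)
  qed
  with lower have "(INF k. E k) = ennreal ?\<chi>"
    by (intro antisym INF_greatest) auto
  moreover have "decseq E"
    unfolding E_def using A
    by (intro decseq_SucI SUP_subset_mono order_refl ennreal_leI hahn_tail_antimono pos) auto
  then have "E \<longlonglongrightarrow> (INF k. E k)" by (rule LIMSEQ_INF)
  ultimately show ?thesis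
    using pos by (simp add: E_def[abs_def] hahn_tail_def abs_of_pos)
qed

end
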